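(* Let $\mathcal X\subseteq\mathbb R^{d_x}$, $\mathcal Y\subseteq\mathbb R^{d_y}$, $\mathcal Z\subseteq\mathbb R^{d_z}$ be nonempty Polish subspaces (with the relative Euclidean topology), $\mathcal Z$ closed, and let $(X,Y)$ be a random vector with values in $\mathcal X\times\mathcal Y$, joint distribution $P$, marginal $P_X$ of $X$ and conditional distributions $P_{Y|X=x}$. Fix $p\ge 1$. Assume: (1) $\rho^{(1)},\rho^{(2)},\rho^{\mathrm{EA}}:L^p\to\mathbb R$ are law-invariant convex risk measures; (2) $\widetilde{\mathcal G}$ is the set of all continuous functions $g:\mathcal X\to\mathcal Z$; (3) the cost function $c(z,y)$ is continuous in $(z,y)$, and there exist $\iota\ge 0$ and a locally bounded non-negative function $\eta:\mathcal Z\to\mathbb R$ with $|c(z,y)|\le\eta(z)(\|y\|^\iota+1)$ for all $(z,y)\in\mathcal Z\times\mathcal Y$; (4) $x\mapsto P_{Y|X=x}$ is continuous on $\mathcal X$ with respect to the $\|\cdot\|^{\iota p}$-weak topology; (5) the support sets $\mathcal X$ and $\mathcal Y$ of $X$ and $Y$ are bounded; (6) there exist a continuous function $r:\mathcal Y\to\mathbb R_+$ with $\sup_{y\in\mathcal Y}|r(y)|<\infty$ and a constant $\nu>0$ such that $|c(z_1,y)-c(z_2,y)|\le r(y)\|z_1-z_2\|^\nu$ for all $z_1,z_2\in\mathcal Z$ and all $y\in\mathcal Y$. Then the functions $$g\mapsto \rho^{\mathrm{EA}}_P\big(c(g(X),Y)\big)\qquad\text{and}\qquad g\mapsto \rho^{(1)}_{P_X}\Big(\rho^{(2)}_{P_{Y|X}}\big(c(g(X),Y)\big)\Big)$$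 are continuous in $g\in\widetilde{\mathcal G}$, with respect to uniform convergence on $\mathcal X$, i.e. the distance $\|g-g_0\|_{\infty,\mathcal X}=\sup_{x\in\mathcal X}\|g(x)-g_0(x)\|$.
   Context: Risk measures. $L^p$ is the space of real random variables with finite $p$-th moment on a nonatomic probability space. A map $\rho:L^p\to\mathbb R$ is a convex risk measure if it is monotone ($\xi\ge\zeta$ a.s. implies $\rho(\xi)\ge\rho(\zeta)$), cash invariant ($\rho(\xi+a)=\rho(\xi)+a$ for $a\in\mathbb R$), and convex. It is law invariant if $\rho(\xi)=\rho(\zeta)$ whenever $\xi,\zeta$ have the same distribution; then it induces a functional $\varrho$ on the set $\mathcal M_1^p$ of probability measures on $\mathbb R$ with finite $p$-th moment, $\varrho(\mu)=\rho(F_\mu^{-1}(U))$, where $U$ is uniform on $[0,1]$ and $F_\mu^{-1}$ is the quantile function of $\mu$. For a probability measure $Q$ (the law of a random element $W$) and a measurable real function $\phi$ with $Q\circ\phi^{-1}\in\mathcal M_1^p$, write $\rho_Q(\phi(W)):=\varrho(Q\circ\phi^{-1})$. Thus $\rho^{(2)}_{P_{Y|X}}(c(g(X),Y))$ is the random variable $\psi_g(X)$ with $\psi_g(x)=\rho^{(2)}_{P_{Y|X=x}}(c(g(x),Y))$, and $\rho^{(1)}_{P_X}$ is then applied to $\psi_g(X)$. $\|\cdot\|^{q}$-weak topology ($q\ge 0$). On the set $\mathcal M^q_d$ of probability measures on $\mathbb R^d$ with $\int\|t\|^q\,P(dt)<\infty$, it is the coarsest topology making $P\mapsto\int h\,dP$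 continuous for every continuous $h:\mathbb R^d\to\mathbb R$ satisfying $|h(t)|\le c_0(\|t\|^q+1)$ for all $t$ and some constant $c_0>0$. *)

theory Defs
  imports "HOL-Probability.Probability"
begin

definition polish_subspace :: "'a::metric_space set \<Rightarrow> bool" where
  "polish_subspace S \<longleftrightarrow>
     completely_metrizable_space (top_of_set S) \<and>
     (\<exists>D. countable D \<and> D \<subseteq> S \<and> S \<subseteq> closure D)"

definition nonatomic :: "'w measure \<Rightarrow> bool" where
  "nonatomic M \<longleftrightarrow>
     (\<forall>A\<in>sets M. emeasure M A > 0 \<longrightarrow>
        (\<exists>B\<in>sets M. B \<subseteq> A \<and> 0 < emeasure M B \<and> emeasure M B < emeasure M A))"

text \<open>Elements of \<open>L\<^sup>p\<close> are functions rather than classes of almost surely equal functions; a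
  functional that is monotone in the almost sure order, as below, respects these classes.\<close>

definition Lp :: "'w measure \<Rightarrow> real \<Rightarrow> ('w \<Rightarrow> real) set" where
  "Lp M p = {\<xi> \<in> borel_measurable M. integrable M (\<lambda>\<omega>. \<bar>\<xi> \<omega>\<bar> powr p)}"

definition convex_risk_measure :: "'w measure \<Rightarrow> real \<Rightarrow> (('w \<Rightarrow> real) \<Rightarrow> real) \<Rightarrow> bool" where
  "convex_risk_measure M p \<rho> \<longleftrightarrow>
     (\<forall>\<xi>\<in>Lp M p. \<forall>\<zeta>\<in>Lp M p. (AE \<omega> in M. \<xi> \<omega> \<ge> \<zeta> \<omega>) \<longrightarrow> \<rho> \<xi> \<ge> \<rho> \<zeta>) \<and>
     (\<forall>\<xi>\<in>Lp M p. \<forall>a. \<rho> (\<lambda>\<omega>. \<xi> \<omega> + a) = \<rho> \<xi> + a) \<and>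
     (\<forall>\<xi>\<in>Lp M p. \<forall>\<zeta>\<in>Lp M p. \<forall>t\<in>{0..1}.
        \<rho> (\<lambda>\<omega>. t * \<xi> \<omega> + (1 - t) * \<zeta> \<omega>) \<le> t * \<rho> \<xi> + (1 - t) * \<rho> \<zeta>)"

definition law_invariant :: "'w measure \<Rightarrow> real \<Rightarrow> (('w \<Rightarrow> real) \<Rightarrow> real) \<Rightarrow> bool" where
  "law_invariant M p \<rho> \<longleftrightarrow>
     (\<forall>\<xi>\<in>Lp M p. \<forall>\<zeta>\<in>Lp M p. distr M borel \<xi> = distr M borel \<zeta> \<longrightarrow> \<rho> \<xi> = \<rho> \<zeta>)"

text \<open>Here \<open>0 powr 0 = 0\<close>, so for \<open>q = 0\<close> the integrand is \<open>0\<close> instead of \<open>1\<close> at the origin; this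
  does not affect integrability. Likewise it only changes the constant \<open>c\<^sub>0\<close> in the growth
  condition of the weak topology.\<close>

definition moment_measures :: "real \<Rightarrow> 'a::euclidean_space measure set" where
  "moment_measures q =
     {\<mu>. prob_space \<mu> \<and> sets \<mu> = sets borel \<and> integrable \<mu> (\<lambda>t. norm t powr q)}"

definition norm_weak_topology :: "real \<Rightarrow> 'a::euclidean_space measure topology" where
  "norm_weak_topology q = topology_generated_by
     {{\<mu> \<in> moment_measures q. (\<integral>t. h t \<partial>\<mu>) \<in> V} | h V.
        continuous_on UNIV h \<and> (\<exists>c0>0. \<forall>t. \<bar>h t\<bar> \<le> c0 * (norm t powr q + 1)) \<and>
        open (V :: real set)}"

text \<open>The values at \<open>u \<le> 0\<close> and \<open>u \<ge> 1\<close> are irrelevant: below \<open>u\<close> is uniform on \<open>[0,1]\<close>.\<close>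

definition quantile :: "real measure \<Rightarrow> real \<Rightarrow> real" where
  "quantile \<mu> u = Inf {x. u \<le> cdf \<mu> x}"

definition law_functional ::
    "('w \<Rightarrow> real) \<Rightarrow> (('w \<Rightarrow> real) \<Rightarrow> real) \<Rightarrow> real measure \<Rightarrow> real" where
  "law_functional U \<rho> \<mu> = \<rho> (\<lambda>\<omega>. quantile \<mu> (U \<omega>))"

definition risk_defined :: "real \<Rightarrow> 'b measure \<Rightarrow> ('b \<Rightarrow> real) \<Rightarrow> bool" where
  "risk_defined p Q \<phi> \<longleftrightarrow> \<phi> \<in> borel_measurable Q \<and> distr Q borel \<phi> \<in> moment_measures p"

text \<open>\<open>risk_under U p \<rho> Q \<phi>\<close> is the value \<open>\<rho>\<^sub>Q(\<phi>(W))\<close>, unspecified where it is not defined.\<close>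

definition risk_under ::
    "('w \<Rightarrow> real) \<Rightarrow> real \<Rightarrow> (('w \<Rightarrow> real) \<Rightarrow> real) \<Rightarrow> 'b measure \<Rightarrow> ('b \<Rightarrow> real) \<Rightarrow> real" where
  "risk_under U p \<rho> Q \<phi> =
     (if risk_defined p Q \<phi> then law_functional U \<rho> (distr Q borel \<phi>) else undefined)"

text \<open>\<open>\<kappa>\<close> is a regular version of the conditional distribution of \<open>Y\<close> given \<open>X\<close>, where \<open>(X, Y)\<close> takes
  values in \<open>S \<times> T\<close> and has joint law \<open>P\<close>, and \<open>X\<close> has law \<open>PX\<close>.\<close>

definition conditional_law ::
    "'a::euclidean_space set \<Rightarrow> 'b::euclidean_space set \<Rightarrow> ('a \<times> 'b) measure \<Rightarrow> 'a measure \<Rightarrow>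
     ('a \<Rightarrow> 'b measure) \<Rightarrow> bool" where
  "conditional_law S T P PX \<kappa> \<longleftrightarrow>
     \<kappa> \<in> restrict_space borel S \<rightarrow>\<^sub>M prob_algebra (restrict_space borel T) \<and>
     (\<forall>A\<in>sets (restrict_space borel S). \<forall>B\<in>sets (restrict_space borel T).
        emeasure P (A \<times> B) = (\<integral>\<^sup>+x\<in>A. emeasure (\<kappa> x) B \<partial>PX))"

definition locally_bounded_on :: "'a::metric_space set \<Rightarrow> ('a \<Rightarrow> real) \<Rightarrow> bool" where
  "locally_bounded_on S f \<longleftrightarrow> (\<forall>z\<in>S. \<exists>e>0. bounded (f ` (ball z e \<inter> S)))"

text \<open>The supremum is taken in the extended nonnegative reals, since the difference of two continuous
  functions may be unbounded. Continuity below is with respect to this extended metric.\<close>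

definition sup_dist :: "'a set \<Rightarrow> ('a \<Rightarrow> 'b::real_normed_vector) \<Rightarrow> ('a \<Rightarrow> 'b) \<Rightarrow> ennreal" where
  "sup_dist S g g0 = (SUP x\<in>S. ennreal (norm (g x - g0 x)))"

definition continuous_sup_dist ::
    "'a set \<Rightarrow> ('a \<Rightarrow> 'b::real_normed_vector) set \<Rightarrow> (('a \<Rightarrow> 'b) \<Rightarrow> real) \<Rightarrow> bool" where
  "continuous_sup_dist S G F \<longleftrightarrow>
     (\<forall>g0\<in>G. \<forall>e>0. \<exists>d>0. \<forall>g\<in>G. sup_dist S g g0 < ennreal d \<longrightarrow> \<bar>F g - F g0\<bar> < e)"

end

theory Submission
  imports Defs
begin

text \<open>By monotonicity and cash invariance a risk measure is 1-Lipschitz in the supremum norm, also after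
  passing to quantiles, and condition (6) bounds the supremum distance of the costs of two decision
  functions \<open>g\<close>, \<open>g\<^sub>0\<close> by a multiple of the \<open>\<nu>\<close>-th power of the supremum distance of \<open>g\<close> and \<open>g\<^sub>0\<close>. This
  gives both continuity claims. If the supremum distance is finite, the two costs differ by a bounded
  function, so both risks are defined or both have the same unspecified value.

  What remains is the measurability of \<open>x \<mapsto> \<rho>\<^bsub>\<kappa> x\<^esub>(c (g x) Y)\<close>. Finite convex risk measures are
  \<open>L\<^sup>p\<close>-continuous (extended Namioka--Klee theorem), hence continuous along bounded pointwise
  convergence. The quantile function of the conditional law of the cost is a bounded pointwise limit
  of functions that take values in a countable set and depend measurably on \<open>x\<close>, so the risk is a
  pointwise limit of measurable functions of \<open>x\<close>.\<close>

subsection \<open>Continuity of convex risk measures in \<open>L\<^sup>p\<close>\<close>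

lemma Lp_dominated:
  assumes "\<zeta> \<in> Lp M p" and [measurable]: "\<xi> \<in> borel_measurable M"
    and "AE \<omega> in M. \<bar>\<xi> \<omega>\<bar> \<le> \<bar>\<zeta> \<omega>\<bar>" and "p \<ge> 0"
  shows "\<xi> \<in> Lp M p"
proof -
  have "integrable M (\<lambda>\<omega>. \<bar>\<xi> \<omega>\<bar> powr p)"
  proof (rule Bochner_Integration.integrable_bound)
    show "integrable M (\<lambda>\<omega>. \<bar>\<zeta> \<omega>\<bar> powr p)"
      using assms(1) by (simp add: Lp_def)
    show "AE \<omega> in M. norm (\<bar>\<xi> \<omega>\<bar> powr p) \<le> norm (\<bar>\<zeta> \<omega>\<bar> powr p)"
      using assms(3) by eventually_elim (simp add: powr_mono2 assms(4))
  qed measurable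
  then show ?thesis
    by (simp add: Lp_def)
qed

lemma Lp_scale:
  assumes "\<xi> \<in> Lp M p"
  shows "(\<lambda>\<omega>. a * \<xi> \<omega>) \<in> Lp M p"
  using assms by (auto simp: Lp_def abs_mult powr_mult)

lemma Lp_add:
  assumes \<xi>: "\<xi> \<in> Lp M p" and \<zeta>: "\<zeta> \<in> Lp M p" and p: "p \<ge> 0"
  shows "(\<lambda>\<omega>. \<xi> \<omega> + \<zeta> \<omega>) \<in> Lp M p"
proof -
  have [measurable]: "\<xi> \<in> borel_measurable M" "\<zeta> \<in> borel_measurable M"
    using \<xi> \<zeta> by (auto simp: Lp_def)
  have "\<bar>a + b\<bar> powr p \<le> 2 powr p * (\<bar>a\<bar> powr p + \<bar>b\<bar> powr p)" for a b :: real
  proof -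
    have "\<bar>a + b\<bar> powr p \<le> (2 * max \<bar>a\<bar> \<bar>b\<bar>) powr p"
      by (rule powr_mono2) (use p in auto)
    also have "\<dots> = 2 powr p * max \<bar>a\<bar> \<bar>b\<bar> powr p"
      by (simp add: powr_mult)
    also have "\<dots> \<le> 2 powr p * (\<bar>a\<bar> powr p + \<bar>b\<bar> powr p)"
      by (intro mult_left_mono) (auto simp: max_def)
    finally show ?thesis .
  qed
  then have le: "norm (\<bar>\<xi> \<omega> + \<zeta> \<omega>\<bar> powr p) \<le> norm (2 powr p * (\<bar>\<xi> \<omega>\<bar> powr p + \<bar>\<zeta> \<omega>\<bar> powr p))" for \<omega>
    by simp
  have "integrable M (\<lambda>\<omega>. \<bar>\<xi> \<omega> + \<zeta> \<omega>\<bar> powr p)"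
  proof (rule Bochner_Integration.integrable_bound)
    show "integrable M (\<lambda>\<omega>. 2 powr p * (\<bar>\<xi> \<omega>\<bar> powr p + \<bar>\<zeta> \<omega>\<bar> powr p))"
      using \<xi> \<zeta> by (simp add: Lp_def)
  qed (use le in auto)
  then show ?thesis
    by (simp add: Lp_def)
qed

lemma Lp_diff:
  assumes "\<xi> \<in> Lp M p" "\<zeta> \<in> Lp M p" "p \<ge> 0"
  shows "(\<lambda>\<omega>. \<xi> \<omega> - \<zeta> \<omega>) \<in> Lp M p"
  using Lp_add[OF assms(1) Lp_scale[OF assms(2), of "-1"] assms(3)] by simp

lemma (in finite_measure) Lp_const: "(\<lambda>_. a) \<in> Lp M p"
  by (simp add: Lp_def)

lemma (in finite_measure) Lp_bounded:
  assumes "\<xi> \<in> borel_measurable M" "AE \<omega> in M. \<bar>\<xi> \<omega>\<bar> \<le> K" "p \<ge> 0"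
  shows "\<xi> \<in> Lp M p"
  by (rule Lp_dominated[OF Lp_const[of K]]) (use assms in auto)

text \<open>The dominating function is the \<open>\<ell>\<^sup>p\<close>-norm of the sequence rather than its sum, so that no
  Minkowski inequality is needed.\<close>

lemma Lp_summable_dominated:
  assumes D: "\<And>k::nat. D k \<in> Lp M p" and p: "p \<ge> 1"
    and sum: "summable (\<lambda>k. \<integral>\<omega>. \<bar>D k \<omega>\<bar> powr p \<partial>M)"
  obtains \<Delta> where "\<Delta> \<in> Lp M p" "AE \<omega> in M. \<forall>k. \<bar>D k \<omega>\<bar> \<le> \<Delta> \<omega>"
proof -
  have [measurable]: "D k \<in> borel_measurable M" for k
    using D by (auto simp: Lp_def)
  let ?f = "\<lambda>k \<omega>. \<bar>D k \<omega>\<bar> powr p"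
  have int: "integrable M (?f k)" for k
    using D by (auto simp: Lp_def)
  have "(\<integral>\<^sup>+\<omega>. (\<Sum>k. ennreal (?f k \<omega>)) \<partial>M) = (\<Sum>k. \<integral>\<^sup>+\<omega>. ennreal (?f k \<omega>) \<partial>M)"
    by (rule nn_integral_suminf) measurable
  also have "\<dots> = (\<Sum>k. ennreal (\<integral>\<omega>. ?f k \<omega> \<partial>M))"
    by (intro suminf_cong nn_integral_eq_integral int) auto
  also have "\<dots> \<noteq> \<infinity>"
    unfolding infinity_ennreal_def by (rule ennreal_suminf_neq_top[OF sum]) simp
  finally have fin: "(\<integral>\<^sup>+\<omega>. (\<Sum>k. ennreal (?f k \<omega>)) \<partial>M) \<noteq> \<infinity>" .
  have "AE \<omega> in M. (\<Sum>k. ennreal (?f k \<omega>)) \<noteq> \<infinity>"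
    by (rule nn_integral_PInf_AE[OF _ fin]) measurable
  then have ae: "AE \<omega> in M. summable (\<lambda>k. ?f k \<omega>)"
    by eventually_elim (intro summable_suminf_not_top, auto)
  define \<Delta> where "\<Delta> \<omega> = (\<Sum>k. ?f k \<omega>) powr (1 / p)" for \<omega>
  have [measurable]: "\<Delta> \<in> borel_measurable M"
    unfolding \<Delta>_def by measurable
  have "integrable M (\<lambda>\<omega>. \<Sum>k. ?f k \<omega>)"
    by (rule integrable_suminf) (use int ae sum in auto)
  then have "integrable M (\<lambda>\<omega>. \<bar>\<Delta> \<omega>\<bar> powr p)"
  proof (rule integrable_cong_AE_imp)
    show "AE \<omega> in M. (\<Sum>k. ?f k \<omega>) = \<bar>\<Delta> \<omega>\<bar> powr p"
      using ae
    proof eventually_elim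
      case (elim \<omega>)
      have "(\<Sum>k. ?f k \<omega>) \<ge> 0"
        by (rule suminf_nonneg[OF elim]) auto
      then show ?case
        using p by (simp add: \<Delta>_def powr_powr)
    qed
  qed measurable
  moreover have "AE \<omega> in M. \<forall>k. \<bar>D k \<omega>\<bar> \<le> \<Delta> \<omega>"
    using ae
  proof eventually_elim
    case (elim \<omega>)
    show ?case
    proof
      fix k
      have "?f k \<omega> \<le> (\<Sum>k. ?f k \<omega>)"
        using sum_le_suminf[OF elim, of "{k}"] by auto
      then have "?f k \<omega> powr (1 / p) \<le> \<Delta> \<omega>"
        unfolding \<Delta>_def by (intro powr_mono2) (use p in auto)
      then show "\<bar>D k \<omega>\<bar> \<le> \<Delta> \<omega>"
        using p by (simp add: powr_powr)
    qed
  qed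
  ultimately show ?thesis
    using that[of \<Delta>] by (simp add: Lp_def)
qed

section \<open>Convexity estimates and continuity of risk measures\<close>

locale convex_risk = prob_space M for M :: "'w measure" +
  fixes p :: real and \<rho> :: "('w \<Rightarrow> real) \<Rightarrow> real"
  assumes p1: "p \<ge> 1" and risk: "convex_risk_measure M p \<rho>"
begin

lemma risk_mono:
  assumes "\<xi> \<in> Lp M p" "\<zeta> \<in> Lp M p" "AE \<omega> in M. \<xi> \<omega> \<le> \<zeta> \<omega>"
  shows "\<rho> \<xi> \<le> \<rho> \<zeta>"
  using risk assms unfolding convex_risk_measure_def by blast

lemma risk_cash: "\<xi> \<in> Lp M p \<Longrightarrow> \<rho> (\<lambda>\<omega>. \<xi> \<omega> + a) = \<rho> \<xi> + a"
  using risk unfolding convex_risk_measure_def by blast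

lemma risk_convex:
  assumes "\<xi> \<in> Lp M p" "\<zeta> \<in> Lp M p" "0 \<le> t" "t \<le> 1"
  shows "\<rho> (\<lambda>\<omega>. t * \<xi> \<omega> + (1 - t) * \<zeta> \<omega>) \<le> t * \<rho> \<xi> + (1 - t) * \<rho> \<zeta>"
  using risk assms unfolding convex_risk_measure_def by auto

text \<open>The convex combinations \<open>\<zeta> = t (\<xi> + (\<zeta> - \<xi>) / t) + (1 - t) \<xi>\<close> and
  \<open>\<xi> = (1 / (1 + t)) \<zeta> + (t / (1 + t)) (\<xi> - (\<zeta> - \<xi>) / t)\<close>, combined with monotonicity.\<close>

lemma risk_bounds:
  assumes \<xi>: "\<xi> \<in> Lp M p" and \<zeta>: "\<zeta> \<in> Lp M p" and \<Delta>: "\<Delta> \<in> Lp M p"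
    and t: "0 < t" "t \<le> 1" and le: "AE \<omega> in M. \<bar>\<zeta> \<omega> - \<xi> \<omega>\<bar> / t \<le> \<Delta> \<omega>"
  shows "\<rho> \<zeta> - \<rho> \<xi> \<le> t * (\<rho> (\<lambda>\<omega>. \<xi> \<omega> + \<Delta> \<omega>) - \<rho> \<xi>)"
    and "\<rho> \<xi> - \<rho> \<zeta> \<le> t * (\<rho> (\<lambda>\<omega>. \<xi> \<omega> + \<Delta> \<omega>) - \<rho> \<xi>)"
proof -
  have p0: "p \<ge> 0"
    using p1 by simp
  \<comment> \<open>\<open>S s\<close> runs along the line through \<open>\<xi>\<close> at
    \<open>s = 0\<close> and \<open>\<zeta>\<close> at \<open>s = 1\<close>. The parameters
    \<open>1 / t\<close> and \<open>- 1 / t\<close> give the two extrapolations, both almost surely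
    at most \<open>\<xi> + \<Delta>\<close>.\<close>
  define S where "S s \<omega> = \<xi> \<omega> + s * (\<zeta> \<omega> - \<xi> \<omega>)" for s \<omega>
  have S: "S s \<in> Lp M p" for s
    unfolding S_def by (intro Lp_add Lp_scale Lp_diff \<xi> \<zeta> p0)
  have \<xi>\<Delta>: "(\<lambda>\<omega>. \<xi> \<omega> + \<Delta> \<omega>) \<in> Lp M p"
    by (intro Lp_add \<xi> \<Delta> p0)
  have up: "\<rho> (S (1 / t)) \<le> \<rho> (\<lambda>\<omega>. \<xi> \<omega> + \<Delta> \<omega>)" "\<rho> (S (- 1 / t)) \<le> \<rho> (\<lambda>\<omega>. \<xi> \<omega> + \<Delta> \<omega>)"
    using le t by (intro risk_mono S \<xi>\<Delta>; auto simp: S_def field_simps abs_le_iff elim!: eventually_mono)+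
  have "\<zeta> = (\<lambda>\<omega>. t * S (1 / t) \<omega> + (1 - t) * \<xi> \<omega>)"
    using t by (auto simp: S_def field_simps)
  then have "\<rho> \<zeta> \<le> t * \<rho> (S (1 / t)) + (1 - t) * \<rho> \<xi>"
    using risk_convex[OF S \<xi>, of t "1 / t"] t by simp
  also have "\<dots> \<le> t * \<rho> (\<lambda>\<omega>. \<xi> \<omega> + \<Delta> \<omega>) + (1 - t) * \<rho> \<xi>"
    using up t by simp
  finally show "\<rho> \<zeta> - \<rho> \<xi> \<le> t * (\<rho> (\<lambda>\<omega>. \<xi> \<omega> + \<Delta> \<omega>) - \<rho> \<xi>)"
    by (simp add: algebra_simps)
  have t': "1 - 1 / (1 + t) = t / (1 + t)" "1 + t \<noteq> 0" "t \<noteq> 0"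
    using t by (auto simp: field_simps)
  have "\<xi> = (\<lambda>\<omega>. 1 / (1 + t) * \<zeta> \<omega> + (1 - 1 / (1 + t)) * S (- 1 / t) \<omega>)"
  proof
    fix \<omega>
    have "(t * S (- 1 / t) \<omega>) = t * \<xi> \<omega> - (\<zeta> \<omega> - \<xi> \<omega>)"
      using t' by (simp add: S_def field_simps)
    then have "1 / (1 + t) * \<zeta> \<omega> + t / (1 + t) * S (- 1 / t) \<omega> = ((1 + t) * \<xi> \<omega>) / (1 + t)"
      by (simp add: algebra_simps flip: add_divide_distrib)
    then show "\<xi> \<omega> = 1 / (1 + t) * \<zeta> \<omega> + (1 - 1 / (1 + t)) * S (- 1 / t) \<omega>"
      unfolding t'(1) using t'(2) by simp
  qed
  then have "\<rho> \<xi> \<le> 1 / (1 + t) * \<rho> \<zeta> + (1 - 1 / (1 + t)) * \<rho> (S (- 1 / t))"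
    using risk_convex[OF \<zeta> S, of "1 / (1 + t)" "- 1 / t"] t by simp
  then have "\<rho> \<xi> \<le> (\<rho> \<zeta> + t * \<rho> (S (- 1 / t))) / (1 + t)"
    unfolding t'(1) by (simp add: add_divide_distrib)
  then have "(1 + t) * \<rho> \<xi> \<le> \<rho> \<zeta> + t * \<rho> (S (- 1 / t))"
    using t by (simp add: pos_le_divide_eq mult.commute)
  also have "\<dots> \<le> \<rho> \<zeta> + t * \<rho> (\<lambda>\<omega>. \<xi> \<omega> + \<Delta> \<omega>)"
    using up t by simp
  finally show "\<rho> \<xi> - \<rho> \<zeta> \<le> t * (\<rho> (\<lambda>\<omega>. \<xi> \<omega> + \<Delta> \<omega>) - \<rho> \<xi>)"
    by (simp add: algebra_simps)
qed

text \<open>A failure yields \<open>Z k\<close> converging to \<open>\<xi>\<close> so fast that the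
  rescaled differences \<open>(Z k - \<xi>) / w k\<close> still have a common majorant
  \<open>\<Delta>\<close> in \<open>Lp\<close>. Then \<open>risk_bounds\<close> with
  \<open>t = w k\<close> forces \<open>e \<le> w k * C\<close> for one constant \<open>C\<close>,
  while \<open>w k\<close> tends to 0.\<close>

lemma risk_Lp_continuous:
  assumes \<xi>: "\<xi> \<in> Lp M p" and e: "e > 0"
  shows "\<exists>d>0. \<forall>\<zeta>\<in>Lp M p. (\<integral>\<omega>. \<bar>\<zeta> \<omega> - \<xi> \<omega>\<bar> powr p \<partial>M) < d \<longrightarrow> \<bar>\<rho> \<zeta> - \<rho> \<xi>\<bar> < e"
proof (rule ccontr)
  assume "\<not> ?thesis"
  then have neg: "\<exists>\<zeta>\<in>Lp M p. (\<integral>\<omega>. \<bar>\<zeta> \<omega> - \<xi> \<omega>\<bar> powr p \<partial>M) < d \<and> \<bar>\<rho> \<zeta> - \<rho> \<xi>\<bar> \<ge> e"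
    if "d > 0" for d
    using that by (meson not_less)
  define w :: "nat \<Rightarrow> real" where "w k = (1/2) ^ k" for k
  have w: "0 < w k" "w k \<le> 1" for k
    by (auto simp: w_def power_le_one)
  \<comment> \<open>The factor \<open>w k powr p\<close> is used up when the difference is divided
    by \<open>w k\<close>; the remaining factor \<open>w k\<close> makes the \<open>p\<close>-th
    moments summable.\<close>
  have "\<forall>k. \<exists>\<zeta>\<in>Lp M p. (\<integral>\<omega>. \<bar>\<zeta> \<omega> - \<xi> \<omega>\<bar> powr p \<partial>M) < w k * w k powr p \<and> \<bar>\<rho> \<zeta> - \<rho> \<xi>\<bar> \<ge> e"
    using neg w by (metis mult_pos_pos powr_gt_zero less_irrefl)
  then obtain Z where Z: "\<And>k. Z k \<in> Lp M p"
      "\<And>k. (\<integral>\<omega>. \<bar>Z k \<omega> - \<xi> \<omega>\<bar> powr p \<partial>M) < w k * w k powr p" "\<And>k. \<bar>\<rho> (Z k) - \<rho> \<xi>\<bar> \<ge> e"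
    by metis
  define D where "D k \<omega> = (1 / w k) * (Z k \<omega> - \<xi> \<omega>)" for k \<omega>
  have D: "D k \<in> Lp M p" for k
    unfolding D_def using p1 by (intro Lp_scale Lp_diff Z \<xi>) auto
  have "(\<integral>\<omega>. \<bar>D k \<omega>\<bar> powr p \<partial>M) \<le> w k" for k
  proof -
    have "(\<integral>\<omega>. \<bar>D k \<omega>\<bar> powr p \<partial>M) = (\<integral>\<omega>. (1 / w k) powr p * \<bar>Z k \<omega> - \<xi> \<omega>\<bar> powr p \<partial>M)"
      using w[of k] by (intro Bochner_Integration.integral_cong) (auto simp: D_def powr_mult abs_mult powr_divide)
    also have "\<dots> = (\<integral>\<omega>. \<bar>Z k \<omega> - \<xi> \<omega>\<bar> powr p \<partial>M) / w k powr p"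
      using w[of k] by (simp add: powr_divide)
    also have "\<dots> \<le> w k"
      using Z(2)[of k] w[of k] by (simp add: divide_le_eq)
    finally show ?thesis .
  qed
  then have le: "norm (\<integral>\<omega>. \<bar>D k \<omega>\<bar> powr p \<partial>M) \<le> w k" for k
    by simp
  have "summable w"
    unfolding w_def by (rule summable_geometric) simp
  then have "summable (\<lambda>k. \<integral>\<omega>. \<bar>D k \<omega>\<bar> powr p \<partial>M)"
    by (rule summable_comparison_test') (rule le)
  then obtain \<Delta> where \<Delta>: "\<Delta> \<in> Lp M p" "AE \<omega> in M. \<forall>k. \<bar>D k \<omega>\<bar> \<le> \<Delta> \<omega>"
    by (rule Lp_summable_dominated[OF D p1])
  let ?C = "\<rho> (\<lambda>\<omega>. \<xi> \<omega> + \<Delta> \<omega>) - \<rho> \<xi>"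
  have "e \<le> w k * ?C" for k
  proof -
    have "AE \<omega> in M. \<bar>Z k \<omega> - \<xi> \<omega>\<bar> / w k \<le> \<Delta> \<omega>"
      using \<Delta>(2)
    proof eventually_elim
      case (elim \<omega>)
      from spec[OF this, of k] w[of k] show ?case
        by (simp add: D_def abs_mult)
    qed
    from risk_bounds[OF \<xi> Z(1) \<Delta>(1) w this] show ?thesis
      using Z(3)[of k] by linarith
  qed
  moreover have "(\<lambda>k. w k * ?C) \<longlonglongrightarrow> 0 * ?C"
    unfolding w_def by (intro tendsto_mult tendsto_const LIMSEQ_power_zero) auto
  ultimately have "e \<le> 0"
    by (intro LIMSEQ_le_const[of "\<lambda>k. w k * ?C" 0 e]) auto
  with e show False
    by simp
qed

text \<open>Dominated convergence with the constant majorant \<open>(2 * K) powr p\<close> turns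
  pointwise convergence into convergence of \<open>p\<close>-th moments, to which
  \<open>risk_Lp_continuous\<close> applies.\<close>

lemma risk_bounded_convergence:
  assumes [measurable]: "\<And>n::nat. \<xi>s n \<in> borel_measurable M" "\<xi> \<in> borel_measurable M"
    and lim: "AE \<omega> in M. (\<lambda>n. \<xi>s n \<omega>) \<longlonglongrightarrow> \<xi> \<omega>"
    and bd: "\<And>n. AE \<omega> in M. \<bar>\<xi>s n \<omega>\<bar> \<le> K" "AE \<omega> in M. \<bar>\<xi> \<omega>\<bar> \<le> K"
  shows "(\<lambda>n. \<rho> (\<xi>s n)) \<longlonglongrightarrow> \<rho> \<xi>"
proof (rule LIMSEQ_I)
  fix e :: real assume "e > 0"
  have Lp: "\<xi>s n \<in> Lp M p" "\<xi> \<in> Lp M p" for n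
    using p1 by (auto intro: Lp_bounded[OF _ bd(1)] Lp_bounded[OF _ bd(2)])
  obtain d where d: "d > 0"
    "\<And>\<zeta>. \<zeta> \<in> Lp M p \<Longrightarrow> (\<integral>\<omega>. \<bar>\<zeta> \<omega> - \<xi> \<omega>\<bar> powr p \<partial>M) < d \<Longrightarrow> \<bar>\<rho> \<zeta> - \<rho> \<xi>\<bar> < e"
    using risk_Lp_continuous[OF Lp(2) \<open>e > 0\<close>] by blast
  have "(\<lambda>n. \<integral>\<omega>. \<bar>\<xi>s n \<omega> - \<xi> \<omega>\<bar> powr p \<partial>M) \<longlonglongrightarrow> (\<integral>\<omega>. 0 \<partial>M)"
  proof (rule integral_dominated_convergence[where w = "\<lambda>_. (2 * K) powr p"])
    show "AE \<omega> in M. (\<lambda>n. \<bar>\<xi>s n \<omega> - \<xi> \<omega>\<bar> powr p) \<longlonglongrightarrow> 0"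
      using lim
    proof eventually_elim
      case (elim \<omega>)
      have "(\<lambda>n. \<bar>\<xi>s n \<omega> - \<xi> \<omega>\<bar>) \<longlonglongrightarrow> 0"
        using tendsto_rabs_zero[OF LIM_zero[OF elim]] .
      then show ?case
        using p1 by (intro tendsto_zero_powrI[where b = p]) auto
    qed
    fix n
    show "AE \<omega> in M. norm (\<bar>\<xi>s n \<omega> - \<xi> \<omega>\<bar> powr p) \<le> (2 * K) powr p"
      using bd(1)[of n] bd(2)
    proof eventually_elim
      case (elim \<omega>)
      then have "\<bar>\<xi>s n \<omega> - \<xi> \<omega>\<bar> \<le> 2 * K"
        by linarith
      then show ?case
        using p1 by (simp add: powr_mono2)
    qed
  qed auto
  then have "eventually (\<lambda>n. (\<integral>\<omega>. \<bar>\<xi>s n \<omega> - \<xi> \<omega>\<bar> powr p \<partial>M) < d) sequentially"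
    by (rule order_tendstoD(2)) (simp add: d(1))
  then have "eventually (\<lambda>n. norm (\<rho> (\<xi>s n) - \<rho> \<xi>) < e) sequentially"
    by eventually_elim (unfold real_norm_def, rule d(2)[OF Lp(1)])
  then show "\<exists>N. \<forall>n\<ge>N. norm (\<rho> (\<xi>s n) - \<rho> \<xi>) < e"
    unfolding eventually_sequentially .
qed

end

subsection \<open>Quantile functions\<close>

text \<open>The Galois connection between quantile function and cdf, the main tool for quantiles
  below. It is confined to \<open>0 < u < 1\<close>, where the set under \<open>Inf\<close> is
  nonempty and bounded below.\<close>

lemma quantile_le_iff:
  assumes "real_distribution \<mu>" "0 < u" "u < 1"
  shows "quantile \<mu> u \<le> t \<longleftrightarrow> u \<le> cdf \<mu> t"
proof -
  interpret cdf_distribution \<mu>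
    using assms(1) by (simp add: cdf_distribution_def)
  show ?thesis
    unfolding quantile_def by (rule pseudoinverse[symmetric, OF assms(2,3)])
qed

lemma quantile_mono:
  assumes \<mu>: "real_distribution \<mu>" and "0 < v" "v \<le> u" "u < 1"
  shows "quantile \<mu> v \<le> quantile \<mu> u"
proof -
  have "u \<le> cdf \<mu> (quantile \<mu> u)"
    using quantile_le_iff[OF \<mu>, of u "quantile \<mu> u"] assms by simp
  then show ?thesis
    using quantile_le_iff[OF \<mu>, of v] assms by simp
qed

lemma measurable_quantile:
  assumes "real_distribution \<mu>"
  shows "quantile \<mu> \<in> borel_measurable borel"
proof -
  interpret cdf_distribution \<mu>
    using assms by (simp add: cdf_distribution_def)
  \<comment> \<open>Default values outside the open unit interval: for \<open>u \<le> 0\<close>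
    every real qualifies, for \<open>u > 1\<close> none does. The single point 1, where the set may
    or may not be empty, gets its own case.\<close>
  let ?g = "\<lambda>u::real. if u \<le> 0 then Inf UNIV else if u = 1 then quantile \<mu> 1 else Inf {}"
  have outside: "quantile \<mu> u = ?g u" if "\<not> (0 < u \<and> u < 1)" for u
  proof -
    consider "u \<le> 0" | "u = 1" | "u > 1"
      using \<open>\<not> (0 < u \<and> u < 1)\<close> by linarith
    then show ?thesis
    proof cases
      case 1
      then have "u \<le> cdf \<mu> x" for x
        using cdf_nonneg[of x] by linarith
      then show ?thesis
        using 1 by (simp add: quantile_def)
    next
      case 3
      then have "\<not> u \<le> cdf \<mu> x" for x
        using cdf_bounded_prob[of x] by linarith
      then show ?thesis
        using 3 by (simp add: quantile_def)
    qed simp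
  qed
  have "(\<lambda>u. if 0 < u \<and> u < 1 then quantile \<mu> u else ?g u) \<in> borel_measurable borel"
  proof (subst measurable_If_restrict_space_iff, safe)
    show "quantile \<mu> \<in> borel_measurable (restrict_space borel {u. 0 < u \<and> u < 1})"
      using measurable_CI unfolding quantile_def[abs_def] greaterThanLessThan_def
        greaterThan_def lessThan_def Int_def by simp
    show "?g \<in> borel_measurable (restrict_space borel {u. \<not> (0 < u \<and> u < 1)})"
      by (rule measurable_restrict_space1) measurable
  qed measurable
  also have "(\<lambda>u. if 0 < u \<and> u < 1 then quantile \<mu> u else ?g u) = quantile \<mu>"
    using outside by (intro ext) metis
  finally show ?thesis .
qed

text \<open>The cdf equals 1 at \<open>K\<close> and 0 left of \<open>- K\<close>; the Galois
  connection transfers both facts to quantiles.\<close>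

lemma quantile_bounded:
  assumes \<mu>: "real_distribution \<mu>" and bd: "AE t in \<mu>. \<bar>t\<bar> \<le> K" and u: "0 < u" "u < 1"
  shows "\<bar>quantile \<mu> u\<bar> \<le> K"
proof -
  interpret real_distribution \<mu>
    by (rule \<mu>)
  have "cdf \<mu> K = 1"
    unfolding cdf_def by (rule prob_eq_1[THEN iffD2]) (use bd in auto)
  then have 1: "quantile \<mu> u \<le> K"
    using quantile_le_iff[OF \<mu> u] u by simp
  have "t < quantile \<mu> u" if "t < - K" for t
  proof -
    have "cdf \<mu> t = 0"
      unfolding cdf_def by (rule prob_eq_0[THEN iffD2]) (use bd that in auto)
    then show ?thesis
      using quantile_le_iff[OF \<mu> u, of t] u by (simp add: not_le[symmetric])
  qed
  then have "- K \<le> quantile \<mu> u"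
    by (meson less_irrefl not_le)
  with 1 show ?thesis
    by (simp add: abs_le_iff)
qed

text \<open>The lower bound is the Galois connection: \<open>cdf \<mu> a < u\<close> eventually
  persists with \<open>v n\<close> in place of \<open>u\<close>. The upper bound is monotonicity,
  which is where the approach from the left enters.\<close>

lemma quantile_left_continuous:
  assumes \<mu>: "real_distribution \<mu>" and u: "0 < u" "u < 1"
    and v: "v \<longlonglongrightarrow> u" "\<And>n. v n < u"
  shows "(\<lambda>n. quantile \<mu> (v n)) \<longlonglongrightarrow> quantile \<mu> u"
proof (rule order_tendstoI)
  have pos: "eventually (\<lambda>n. 0 < v n) sequentially"
    using order_tendstoD(1)[OF v(1) u(1)] .
  fix a
  {
    assume "a < quantile \<mu> u"
    then have "cdf \<mu> a < u"
      using quantile_le_iff[OF \<mu> u] by (simp add: not_le[symmetric])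
    from order_tendstoD(1)[OF v(1) this] pos
    show "eventually (\<lambda>n. a < quantile \<mu> (v n)) sequentially"
    proof eventually_elim
      case (elim n)
      then show ?case
        using quantile_le_iff[OF \<mu>, of "v n" a] v(2)[of n] u by simp
    qed
  next
    assume "quantile \<mu> u < a"
    show "eventually (\<lambda>n. quantile \<mu> (v n) < a) sequentially"
      using pos
    proof eventually_elim
      case (elim n)
      then show ?case
        using quantile_mono[OF \<mu>, of "v n" u] v(2)[of n] u \<open>quantile \<mu> u < a\<close> by simp
    qed
  }
qed

text \<open>A discretization of the quantile function in time and value: at level \<open>n\<close> it is determined by a
  list of integers, hence ranges over a countable set of functions. The time \<open>j / (n + 1)\<close> lies
  strictly to the left of \<open>u\<close>, because quantile functions are left-continuous.\<close>

definition quantile_grid :: "nat \<Rightarrow> real measure \<Rightarrow> int list" where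
  "quantile_grid n \<mu> =
     map (\<lambda>j. if j = 0 then 0 else \<lfloor>real (Suc n) * quantile \<mu> (real j / real (Suc n))\<rfloor>) [0..<Suc n]"

definition grid_function :: "nat \<Rightarrow> int list \<Rightarrow> real \<Rightarrow> real" where
  "grid_function n l u = real_of_int (l ! nat (\<lceil>real (Suc n) * u\<rceil> - 1)) / real (Suc n)"

lemma length_quantile_grid: "length (quantile_grid n \<mu>) = Suc n"
  by (simp add: quantile_grid_def)

lemma quantile_grid_nth:
  "j < Suc n \<Longrightarrow> quantile_grid n \<mu> ! j =
    (if j = 0 then 0 else \<lfloor>real (Suc n) * quantile \<mu> (real j / real (Suc n))\<rfloor>)"
  using nth_map_upt[of j "Suc n" 0] unfolding quantile_grid_def diff_zero add_0 by blast

lemma measurable_grid_function [measurable]: "grid_function n l \<in> borel_measurable borel"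
  unfolding grid_function_def by measurable

text \<open>The index in \<open>grid_function\<close> is the largest \<open>j\<close> with
  \<open>j / (n + 1)\<close> strictly below \<open>u\<close>. Ceiling minus one, unlike the floor,
  stays strict when \<open>(n + 1) * u\<close> is an integer.\<close>

lemma grid_index:
  fixes u :: real and n :: nat
  assumes "0 < u" "u < 1"
  defines "j \<equiv> nat (\<lceil>real (Suc n) * u\<rceil> - 1)"
  shows "real j / real (Suc n) < u" "u - 1 / real (Suc n) \<le> real j / real (Suc n)" "j < Suc n"
proof -
  have "\<lceil>real (Suc n) * u\<rceil> \<ge> 1"
    using assms by simp
  then have j: "real j = real_of_int \<lceil>real (Suc n) * u\<rceil> - 1"
    by (simp add: j_def)
  have j1: "real j < real (Suc n) * u" "real (Suc n) * u - 1 \<le> real j"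
    unfolding j by linarith+
  then show "real j / real (Suc n) < u"
    by (simp add: divide_less_eq mult.commute)
  then have "real j / real (Suc n) < 1"
    using \<open>u < 1\<close> by (rule less_trans)
  then show "j < Suc n"
    by (simp add: divide_less_eq)
  have "(real (Suc n) * u - 1) / real (Suc n) \<le> real j / real (Suc n)"
    by (rule divide_right_mono[OF j1(2)]) simp
  then show "u - 1 / real (Suc n) \<le> real j / real (Suc n)"
    by (simp add: diff_divide_distrib)
qed

lemma floor_div_bounds:
  fixes q N :: real
  assumes "N > 0"
  shows "q - 1 / N \<le> of_int \<lfloor>N * q\<rfloor> / N" "of_int \<lfloor>N * q\<rfloor> / N \<le> q"
proof -
  have "(N * q - 1) / N \<le> of_int \<lfloor>N * q\<rfloor> / N"
    using assms by (intro divide_right_mono) linarith+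
  then show "q - 1 / N \<le> of_int \<lfloor>N * q\<rfloor> / N"
    using assms by (simp add: diff_divide_distrib)
  have "of_int \<lfloor>N * q\<rfloor> / N \<le> N * q / N"
    using assms by (intro divide_right_mono) linarith+
  then show "of_int \<lfloor>N * q\<rfloor> / N \<le> q"
    using assms by simp
qed

text \<open>The grid point \<open>v n\<close> vanishes when \<open>u \<le> 1 / (n + 1)\<close>,
  hence only for finitely many \<open>n\<close> at fixed \<open>u\<close>. There the entry 0
  replaces the default value of \<open>quantile\<close> at 0.\<close>

lemma grid_function_quantile_grid:
  assumes u: "0 < u" "u < 1"
  defines "v \<equiv> \<lambda>n. real (nat (\<lceil>real (Suc n) * u\<rceil> - 1)) / real (Suc n)"
  shows "grid_function n (quantile_grid n \<mu>) u =
    (if v n = 0 then 0 else of_int \<lfloor>real (Suc n) * quantile \<mu> (v n)\<rfloor> / real (Suc n))"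
proof -
  let ?j = "nat (\<lceil>real (Suc n) * u\<rceil> - 1)"
  have "quantile_grid n \<mu> ! ?j =
      (if ?j = 0 then 0 else \<lfloor>real (Suc n) * quantile \<mu> (real ?j / real (Suc n))\<rfloor>)"
    by (rule quantile_grid_nth[OF grid_index(3)[OF u]])
  moreover have "v n = 0 \<longleftrightarrow> ?j = 0"
    unfolding v_def by (simp del: of_nat_Suc)
  ultimately show ?thesis
    by (simp add: grid_function_def v_def del: of_nat_Suc)
qed

text \<open>Rounding in time moves \<open>u\<close> to \<open>v n\<close> from the left, and
  rounding in value costs at most \<open>1 / (n + 1)\<close>; left-continuity and a sandwich absorb
  both errors.\<close>

lemma grid_function_converges:
  assumes \<mu>: "real_distribution \<mu>" and u: "0 < u" "u < 1"
  shows "(\<lambda>n. grid_function n (quantile_grid n \<mu>) u) \<longlonglongrightarrow> quantile \<mu> u"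
proof -
  define v where "v n = real (nat (\<lceil>real (Suc n) * u\<rceil> - 1)) / real (Suc n)" for n
  note gi = grid_index[OF u, folded v_def]
  have inv: "(\<lambda>n. a - 1 / real (Suc n)) \<longlonglongrightarrow> a" for a :: real
    using tendsto_diff[OF tendsto_const lim_1_over_n[THEN LIMSEQ_Suc], of a] by simp
  have "v \<longlonglongrightarrow> u"
    by (rule tendsto_sandwich[OF _ _ inv tendsto_const])
       (use gi in \<open>auto intro!: always_eventually less_imp_le simp del: of_nat_Suc\<close>)
  then have lim: "(\<lambda>n. quantile \<mu> (v n)) \<longlonglongrightarrow> quantile \<mu> u"
    and pos: "eventually (\<lambda>n. 0 < v n) sequentially"
    using quantile_left_continuous[OF \<mu> u] gi(1) order_tendstoD(1)[OF _ u(1)] by auto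
  have lim': "(\<lambda>n. quantile \<mu> (v n) - 1 / real (Suc n)) \<longlonglongrightarrow> quantile \<mu> u"
    using tendsto_diff[OF lim lim_1_over_n[THEN LIMSEQ_Suc]] by simp
  note eq = grid_function_quantile_grid[OF u, folded v_def]
  show ?thesis
  proof (rule tendsto_sandwich[OF _ _ lim' lim])
    show "eventually (\<lambda>n. quantile \<mu> (v n) - 1 / real (Suc n)
        \<le> grid_function n (quantile_grid n \<mu>) u) sequentially"
      using pos by eventually_elim (use floor_div_bounds(1) in \<open>simp add: eq del: of_nat_Suc\<close>)
    show "eventually (\<lambda>n. grid_function n (quantile_grid n \<mu>) u \<le> quantile \<mu> (v n)) sequentially"
      using pos by eventually_elim (use floor_div_bounds(2) in \<open>simp add: eq del: of_nat_Suc\<close>)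
  qed
qed

text \<open>The extra 1 covers the rounding error of the floor, uniformly in
  \<open>n\<close>.\<close>

lemma grid_function_bounded:
  assumes \<mu>: "real_distribution \<mu>" and bd: "AE t in \<mu>. \<bar>t\<bar> \<le> K" and u: "0 < u" "u < 1"
  shows "\<bar>grid_function n (quantile_grid n \<mu>) u\<bar> \<le> K + 1"
proof -
  define v where "v n = real (nat (\<lceil>real (Suc n) * u\<rceil> - 1)) / real (Suc n)" for n
  note eq = grid_function_quantile_grid[OF u, folded v_def]
  have K: "0 \<le> K"
    using quantile_bounded[OF \<mu> bd u] by simp
  show ?thesis
  proof (cases "v n = 0")
    case True
    then show ?thesis
      using K by (simp add: eq)
  next
    case False
    moreover have "v n \<ge> 0" "v n < u"
      using grid_index(1)[OF u, of n] by (auto simp: v_def)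
    ultimately have "\<bar>quantile \<mu> (v n)\<bar> \<le> K"
      using u by (intro quantile_bounded[OF \<mu> bd]) auto
    moreover have "1 / real (Suc n) \<le> 1"
      by simp
    ultimately show ?thesis
      using floor_div_bounds[of "real (Suc n)" "quantile \<mu> (v n)"]
      unfolding eq if_not_P[OF False] by linarith
  qed
qed

text \<open>By the Galois connection a sublevel set in \<open>x\<close> becomes a superlevel set of
  \<open>x \<mapsto> \<mu> x {..t}\<close>, and evaluation of a kernel on a fixed set is
  measurable.\<close>

lemma measurable_quantile_kernel:
  assumes \<mu>: "\<mu> \<in> N \<rightarrow>\<^sub>M prob_algebra borel" and u: "0 < u" "u < 1"
  shows "(\<lambda>x. quantile (\<mu> x) u) \<in> borel_measurable N"
proof (rule borel_measurableI_le)
  fix t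
  have real: "real_distribution (\<mu> x)" if "x \<in> space N" for x
    using measurable_space[OF \<mu> that]
    by (auto simp: space_prob_algebra real_distribution_def real_distribution_axioms_def)
  have [measurable]: "\<mu> \<in> N \<rightarrow>\<^sub>M subprob_algebra borel"
    by (rule measurable_prob_algebraD[OF \<mu>])
  have "{x \<in> space N. quantile (\<mu> x) u \<le> t} = {x \<in> space N. u \<le> measure (\<mu> x) {..t}}"
    using quantile_le_iff[OF real u] by (auto simp: cdf_def)
  also have "\<dots> \<in> sets N"
    by measurable
  finally show "{x \<in> space N. quantile (\<mu> x) u \<le> t} \<in> sets N" .
qed

text \<open>Integer lists form a countable set, so preimages of single lists suffice, and each of
  them imposes finitely many conditions on quantiles.\<close>

lemma measurable_quantile_grid:
  assumes \<mu>: "\<mu> \<in> N \<rightarrow>\<^sub>M prob_algebra borel"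
  shows "(\<lambda>x. quantile_grid n (\<mu> x)) \<in> N \<rightarrow>\<^sub>M count_space UNIV"
proof -
  let ?q = "\<lambda>j x. if j = 0 then 0 else \<lfloor>real (Suc n) * quantile (\<mu> x) (real j / real (Suc n))\<rfloor>"
  have q: "?q j \<in> N \<rightarrow>\<^sub>M count_space UNIV" if "j < Suc n" for j
  proof (cases "j = 0")
    case False
    then have "(\<lambda>x. quantile (\<mu> x) (real j / real (Suc n))) \<in> borel_measurable N"
      using that by (intro measurable_quantile_kernel[OF \<mu>]) auto
    then show ?thesis
      using False by simp
  qed simp
  then have q': "{x \<in> space N. ?q j x = i} \<in> sets N" if "j < Suc n" for j i
    using measurable_sets[OF q[OF that], of "{i}"] by (simp add: vimage_def Int_def conj_commute)
  have "(\<lambda>x. quantile_grid n (\<mu> x)) -` {l} \<inter> space N \<in> sets N" for l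
  proof (cases "length l = Suc n")
    case True
    have "(\<lambda>x. quantile_grid n (\<mu> x)) -` {l} \<inter> space N =
        {x \<in> space N. \<forall>j\<in>{..<Suc n}. ?q j x = l ! j}"
      using True by (auto simp: list_eq_iff_nth_eq quantile_grid_nth length_quantile_grid
          simp del: of_nat_Suc)
    also have "\<dots> \<in> sets N"
      by (intro sets.sets_Collect_finite_All q') auto
    finally show ?thesis .
  next
    case False
    then have "(\<lambda>x. quantile_grid n (\<mu> x)) -` {l} \<inter> space N = {}"
      by (auto simp: length_quantile_grid)
    then show ?thesis
      by simp
  qed
  then show ?thesis
    unfolding measurable_count_space_eq2_countable by blast
qed

subsection \<open>Risk of a distribution\<close>

lemma moment_measures_real_distribution: "\<mu> \<in> moment_measures p \<Longrightarrow> real_distribution \<mu>"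
  by (simp add: moment_measures_def real_distribution_def real_distribution_axioms_def)

text \<open>By change of variables the image law has a finite \<open>p\<close>-th moment exactly
  when \<open>\<phi>\<close> has one under \<open>Q\<close>, so definedness is decided by
  \<open>Lp\<close> arithmetic on \<open>Q\<close> itself.\<close>

lemma risk_defined_iff_Lp:
  assumes "prob_space Q"
  shows "risk_defined p Q \<phi> \<longleftrightarrow> \<phi> \<in> Lp Q p"
proof (cases "\<phi> \<in> borel_measurable Q")
  case True
  then show ?thesis
    using prob_space.prob_space_distr[OF assms True]
    by (simp add: risk_defined_def moment_measures_def Lp_def integrable_distr_eq)
next
  case False
  then show ?thesis
    by (simp add: risk_defined_def Lp_def)
qed

text \<open>Turns a pointwise bound between costs into one between cdfs: the event
  \<open>\<phi>2 \<le> t\<close> lies in the event \<open>\<phi>1 \<le> t + d\<close>.\<close>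

lemma cdf_distr_shift:
  assumes Q: "prob_space Q" and [measurable]: "\<phi>1 \<in> borel_measurable Q" "\<phi>2 \<in> borel_measurable Q"
    and le: "\<And>w. w \<in> space Q \<Longrightarrow> \<phi>1 w \<le> \<phi>2 w + d"
  shows "cdf (distr Q borel \<phi>2) t \<le> cdf (distr Q borel \<phi>1) (t + d)"
proof -
  interpret prob_space Q
    by (rule Q)
  have "prob (\<phi>2 -` {..t} \<inter> space Q) \<le> prob (\<phi>1 -` {..t + d} \<inter> space Q)"
    by (rule finite_measure_mono) (use le in \<open>force, measurable\<close>)
  then show ?thesis
    by (simp add: cdf_def measure_distr)
qed

section \<open>Risk functionals of laws, realized by a uniform variable\<close>

locale uniform_convex_risk = convex_risk +
  fixes U :: "'a \<Rightarrow> real"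
  assumes measurable_U [measurable]: "U \<in> borel_measurable M"
    and uniform_U: "distr M borel U = uniform_measure lborel {0..1}"
begin

text \<open>The endpoints are null, so \<open>U\<close> almost surely avoids the default values of
  \<open>quantile\<close>.\<close>

lemma AE_U: "AE \<omega> in M. 0 < U \<omega> \<and> U \<omega> < 1"
proof -
  have "AE u in uniform_measure lborel {0..1::real}. 0 < u \<and> u < 1"
    using AE_lborel_singleton[of "0::real"] AE_lborel_singleton[of "1::real"]
    by (subst AE_uniform_measure) (auto elim!: eventually_elim2)
  then show ?thesis
    unfolding uniform_U[symmetric] by (subst (asm) AE_distr_iff) auto
qed

text \<open>Inverse transform sampling: by the Galois connection,
  \<open>quantile \<mu> (U \<omega>) \<le> t\<close> is almost surely the event
  \<open>U \<omega> \<le> cdf \<mu> t\<close>.\<close>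

lemma distr_quantile_U:
  assumes \<mu>: "real_distribution \<mu>"
  shows "distr M borel (\<lambda>\<omega>. quantile \<mu> (U \<omega>)) = \<mu>" (is "?D = \<mu>")
proof (rule cdf_unique)
  note [measurable] = measurable_quantile[OF \<mu>]
  interpret \<mu>: real_distribution \<mu>
    by (rule \<mu>)
  show "real_distribution ?D"
    by (rule real_distribution_distr) measurable
  show "cdf ?D = cdf \<mu>"
  proof
    fix t
    have c: "0 \<le> cdf \<mu> t" "cdf \<mu> t \<le> 1"
      by (rule \<mu>.cdf_nonneg, rule \<mu>.cdf_bounded_prob)
    have "cdf ?D t = prob {\<omega> \<in> space M. quantile \<mu> (U \<omega>) \<le> t}"
      by (auto simp: cdf_def measure_distr intro!: arg_cong[where f = prob])
    also have "\<dots> = prob {\<omega> \<in> space M. U \<omega> \<le> cdf \<mu> t}"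
    proof (rule finite_measure_eq_AE)
      show "AE \<omega> in M. \<omega> \<in> {\<omega> \<in> space M. quantile \<mu> (U \<omega>) \<le> t}
          \<longleftrightarrow> \<omega> \<in> {\<omega> \<in> space M. U \<omega> \<le> cdf \<mu> t}"
        using AE_U by eventually_elim (simp add: quantile_le_iff[OF \<mu>])
    qed measurable
    also have "\<dots> = measure (distr M borel U) {..cdf \<mu> t}"
      by (auto simp: measure_distr intro!: arg_cong[where f = prob])
    also have "\<dots> = measure lborel {0..cdf \<mu> t}"
      unfolding uniform_U using c
      by (auto simp: measure_uniform_measure Int_atLeastAtMost
          intro!: arg_cong[where f = "measure lborel"])
    also have "\<dots> = cdf \<mu> t"
      using c by simp
    finally show "cdf ?D t = cdf \<mu> t" .
  qed
qed (rule \<mu>)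

lemma quantile_U_Lp:
  assumes "\<mu> \<in> moment_measures p"
  shows "(\<lambda>\<omega>. quantile \<mu> (U \<omega>)) \<in> Lp M p"
proof -
  have \<mu>: "real_distribution \<mu>"
    using assms by (rule moment_measures_real_distribution)
  note [measurable] = measurable_quantile[OF \<mu>]
  have "integrable (distr M borel (\<lambda>\<omega>. quantile \<mu> (U \<omega>))) (\<lambda>t. \<bar>t\<bar> powr p)"
    using assms unfolding distr_quantile_U[OF \<mu>] by (simp add: moment_measures_def)
  then show ?thesis
    by (subst (asm) integrable_distr_eq) (auto simp: Lp_def)
qed

text \<open>The cdf hypothesis is stochastic dominance of \<open>\<mu>1\<close> by
  \<open>\<mu>2\<close> shifted by \<open>d\<close>. The same \<open>U\<close> in both quantile
  functions makes it an almost sure inequality, to which monotonicity and cash invariance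
  apply.\<close>

lemma law_functional_shift_mono:
  assumes \<mu>1: "\<mu>1 \<in> moment_measures p" and \<mu>2: "\<mu>2 \<in> moment_measures p"
    and le: "\<And>t. cdf \<mu>2 t \<le> cdf \<mu>1 (t + d)"
  shows "law_functional U \<rho> \<mu>1 \<le> law_functional U \<rho> \<mu>2 + d"
proof -
  note q1 = quantile_le_iff[OF moment_measures_real_distribution[OF \<mu>1]]
  note q2 = quantile_le_iff[OF moment_measures_real_distribution[OF \<mu>2]]
  \<comment> \<open>Taking \<open>t = quantile \<mu>2 u\<close> gives
    \<open>u \<le> cdf \<mu>2 t \<le> cdf \<mu>1 (t + d)\<close>.\<close>
  have q: "quantile \<mu>1 u \<le> quantile \<mu>2 u + d" if u: "0 < u" "u < 1" for u
    using q1[OF u] q2[OF u, of "quantile \<mu>2 u"] le[of "quantile \<mu>2 u"] by simp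
  from AE_U have "AE \<omega> in M. quantile \<mu>1 (U \<omega>) \<le> quantile \<mu>2 (U \<omega>) + d"
    by eventually_elim (simp add: q)
  then have "\<rho> (\<lambda>\<omega>. quantile \<mu>1 (U \<omega>)) \<le> \<rho> (\<lambda>\<omega>. quantile \<mu>2 (U \<omega>) + d)"
    using p1 by (intro risk_mono Lp_add Lp_const quantile_U_Lp \<mu>1 \<mu>2) auto
  then show ?thesis
    unfolding law_functional_def risk_cash[OF quantile_U_Lp[OF \<mu>2]] .
qed

text \<open>Shift monotonicity is applied in both directions. The bounded difference lies in
  \<open>Lp\<close>, so the two risks are defined together; if neither is, both equal
  \<open>undefined\<close> and their difference 0 is at most \<open>d\<close>, as
  \<open>space Q\<close> is nonempty.\<close>

lemma risk_under_lipschitz: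
  assumes Q: "prob_space Q" and \<phi>: "\<phi>1 \<in> borel_measurable Q" "\<phi>2 \<in> borel_measurable Q"
    and le: "\<And>w. w \<in> space Q \<Longrightarrow> \<bar>\<phi>1 w - \<phi>2 w\<bar> \<le> d"
  shows "\<bar>risk_under U p \<rho> Q \<phi>1 - risk_under U p \<rho> Q \<phi>2\<bar> \<le> d"
proof -
  interpret Q: prob_space Q
    by (rule Q)
  have p0: "p \<ge> 0"
    using p1 by simp
  obtain w where "w \<in> space Q"
    using Q.not_empty by blast
  then have d: "0 \<le> d"
    using le by fastforce
  have diff: "(\<lambda>w. \<phi>1 w - \<phi>2 w) \<in> Lp Q p"
    by (rule Q.Lp_bounded[where K = d]) (use \<phi> le p0 in auto)
  have "\<phi>1 \<in> Lp Q p \<longleftrightarrow> \<phi>2 \<in> Lp Q p"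
    using Lp_add[OF _ diff p0, of \<phi>2] Lp_diff[OF _ diff p0, of \<phi>1] by auto
  then have iff: "risk_defined p Q \<phi>1 \<longleftrightarrow> risk_defined p Q \<phi>2"
    by (simp add: risk_defined_iff_Lp[OF Q])
  show ?thesis
  proof (cases "risk_defined p Q \<phi>1")
    case True
    then have m: "distr Q borel \<phi>1 \<in> moment_measures p" "distr Q borel \<phi>2 \<in> moment_measures p"
      using iff by (simp_all add: risk_defined_def)
    have "law_functional U \<rho> (distr Q borel \<phi>1) \<le> law_functional U \<rho> (distr Q borel \<phi>2) + d"
      by (intro law_functional_shift_mono m cdf_distr_shift Q \<phi>) (use le in \<open>force simp: abs_le_iff\<close>)
    moreover have "law_functional U \<rho> (distr Q borel \<phi>2) \<le> law_functional U \<rho> (distr Q borel \<phi>1) + d"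
      by (intro law_functional_shift_mono m cdf_distr_shift Q \<phi>) (use le in \<open>force simp: abs_le_iff\<close>)
    ultimately show ?thesis
      using True iff by (simp add: risk_under_def)
  next
    case False
    then show ?thesis
      using iff d by (simp add: risk_under_def)
  qed
qed

text \<open>Zero cost has the same law under every \<open>Q\<close>; its risk serves as a reference
  value independent of \<open>x\<close> for bounding conditional risks.\<close>

lemma risk_under_zero:
  assumes "prob_space Q"
  shows "risk_under U p \<rho> Q (\<lambda>_. 0) = law_functional U \<rho> (return borel 0)"
proof -
  interpret Q: prob_space Q
    by (rule assms)
  have "risk_defined p Q (\<lambda>_. 0)"
    by (simp add: risk_defined_iff_Lp[OF assms] Q.Lp_const)
  then show ?thesis
    by (simp add: risk_under_def Q.distr_const)
qed

text \<open>The limit is taken at each \<open>x\<close> separately, so the bound \<open>K\<close>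
  may vary with \<open>x\<close>.\<close>

lemma measurable_law_functional:
  assumes \<mu>: "\<mu> \<in> N \<rightarrow>\<^sub>M prob_algebra borel"
    and bd: "\<And>x. x \<in> space N \<Longrightarrow> \<exists>K. AE t in \<mu> x. \<bar>t\<bar> \<le> K"
  shows "(\<lambda>x. law_functional U \<rho> (\<mu> x)) \<in> borel_measurable N"
proof (rule borel_measurable_LIMSEQ_real)
  fix n
  \<comment> \<open>The value depends on \<open>x\<close> only through the grid, an element of a
    discrete space on which every function is measurable.\<close>
  show "(\<lambda>x. \<rho> (\<lambda>\<omega>. grid_function n (quantile_grid n (\<mu> x)) (U \<omega>))) \<in> borel_measurable N"
    by (rule measurable_compose[OF measurable_quantile_grid[OF \<mu>]]) simp
next
  fix x assume x: "x \<in> space N"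
  have real: "real_distribution (\<mu> x)"
    using measurable_space[OF \<mu> x]
    by (auto simp: space_prob_algebra real_distribution_def real_distribution_axioms_def)
  note [measurable] = measurable_quantile[OF real]
  obtain K where K: "AE t in \<mu> x. \<bar>t\<bar> \<le> K"
    using bd[OF x] by blast
  show "(\<lambda>n. \<rho> (\<lambda>\<omega>. grid_function n (quantile_grid n (\<mu> x)) (U \<omega>)))
      \<longlonglongrightarrow> law_functional U \<rho> (\<mu> x)"
    unfolding law_functional_def
  proof (rule risk_bounded_convergence[where K = "K + 1"])
    show "AE \<omega> in M. (\<lambda>n. grid_function n (quantile_grid n (\<mu> x)) (U \<omega>))
        \<longlonglongrightarrow> quantile (\<mu> x) (U \<omega>)"
      using AE_U by eventually_elim (auto intro: grid_function_converges[OF real])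
    show "AE \<omega> in M. \<bar>quantile (\<mu> x) (U \<omega>)\<bar> \<le> K + 1"
      using AE_U by eventually_elim (use quantile_bounded[OF real K] in fastforce)
    show "AE \<omega> in M. \<bar>grid_function n (quantile_grid n (\<mu> x)) (U \<omega>)\<bar> \<le> K + 1" for n
      using AE_U by eventually_elim (use grid_function_bounded[OF real K] in blast)
  qed measurable
qed

end

section \<open>Continuity in the decision function\<close>

lemma sup_dist_less_imp:
  assumes "sup_dist S g g0 < ennreal d" "x \<in> S"
  shows "norm (g x - g0 x) < d"
proof -
  have "ennreal (norm (g x - g0 x)) \<le> sup_dist S g g0"
    unfolding sup_dist_def by (rule SUP_upper) (rule assms(2))
  then show ?thesis
    using assms(1) ennreal_less_iff[OF norm_ge_zero] by (metis le_less_trans)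
qed

text \<open>Links two sigma-algebras on \<open>S \<times> T\<close>: continuity of the cost gives
  measurability for the Borel sets of the subspace, while kernels call for the product
  sigma-algebra.\<close>

lemma measurable_pair_restrict_borel:
  fixes S :: "'a::second_countable_topology set" and T :: "'b::second_countable_topology set"
  shows "(\<lambda>w. w) \<in> restrict_space borel S \<Otimes>\<^sub>M restrict_space borel T \<rightarrow>\<^sub>M restrict_space borel (S \<times> T)"
proof (rule measurable_restrict_space2)
  show "(\<lambda>w. w) \<in> space (restrict_space borel S \<Otimes>\<^sub>M restrict_space borel T) \<rightarrow> S \<times> T"
    by (auto simp: space_pair_measure space_restrict_space)
  have "fst \<in> borel_measurable (restrict_space borel S \<Otimes>\<^sub>M restrict_space borel T)"
    "snd \<in> borel_measurable (restrict_space borel S \<Otimes>\<^sub>M restrict_space borel T)"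
    using measurable_compose[OF measurable_fst measurable_restrict_space1[OF measurable_ident]]
      measurable_compose[OF measurable_snd measurable_restrict_space1[OF measurable_ident]]
    by simp_all
  then have "(\<lambda>w. (fst w, snd w)) \<in> borel_measurable (restrict_space borel S \<Otimes>\<^sub>M restrict_space borel T)"
    by (rule borel_measurable_Pair)
  then show "(\<lambda>w. w) \<in> borel_measurable (restrict_space borel S \<Otimes>\<^sub>M restrict_space borel T)"
    by simp
qed

text \<open>Besides continuity, the conclusion records when the risks are genuinely defined. A
  continuous \<open>g\<close> on a bounded but nonclosed \<open>XX\<close> may be unbounded, and the
  cost may then lack a \<open>p\<close>-th moment; hence the condition of a closed \<open>XX\<close>
  or a bounded image for the joint and nested risks.\<close>

theorem proposition3p2:
  fixes XX :: "(real ^ 'dx) set" and YY :: "(real ^ 'dy) set" and ZZ :: "(real ^ 'dz) set"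
    and \<Omega> :: "'o measure" and X :: "'o \<Rightarrow> real ^ 'dx" and Y :: "'o \<Rightarrow> real ^ 'dy"
    and P :: "((real ^ 'dx) \<times> (real ^ 'dy)) measure" and PX :: "(real ^ 'dx) measure"
    and \<kappa> :: "real ^ 'dx \<Rightarrow> (real ^ 'dy) measure"
    and M :: "'w measure" and U :: "'w \<Rightarrow> real" and p :: real
    and \<rho>1 \<rho>2 \<rho>EA :: "('w \<Rightarrow> real) \<Rightarrow> real"
    and G :: "(real ^ 'dx \<Rightarrow> real ^ 'dz) set"
    and c :: "real ^ 'dz \<Rightarrow> real ^ 'dy \<Rightarrow> real" and \<iota> :: real and \<eta> :: "real ^ 'dz \<Rightarrow> real"
    and r :: "real ^ 'dy \<Rightarrow> real" and \<nu> :: real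
  assumes "XX \<noteq> {}" and "YY \<noteq> {}" and "ZZ \<noteq> {}"
    and "polish_subspace XX" and "polish_subspace YY" and "polish_subspace ZZ" and "closed ZZ"
    and "prob_space \<Omega>"
    and "X \<in> \<Omega> \<rightarrow>\<^sub>M restrict_space borel XX" and "Y \<in> \<Omega> \<rightarrow>\<^sub>M restrict_space borel YY"
    and "P = distr \<Omega> (restrict_space borel (XX \<times> YY)) (\<lambda>\<omega>. (X \<omega>, Y \<omega>))"
    and "PX = distr \<Omega> (restrict_space borel XX) X"
    and "conditional_law XX YY P PX \<kappa>"
    and "prob_space M" and "nonatomic M"
    and "U \<in> borel_measurable M" and "distr M borel U = uniform_measure lborel {0..1}"
    and "p \<ge> 1"
    and "convex_risk_measure M p \<rho>1" and "law_invariant M p \<rho>1"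
    and "convex_risk_measure M p \<rho>2" and "law_invariant M p \<rho>2"
    and "convex_risk_measure M p \<rho>EA" and "law_invariant M p \<rho>EA"
    and "G = {g. continuous_on XX g \<and> g ` XX \<subseteq> ZZ}"
    and "continuous_on (ZZ \<times> YY) (\<lambda>(z, y). c z y)"
    and "\<iota> \<ge> 0" and "\<forall>z\<in>ZZ. \<eta> z \<ge> 0" and "locally_bounded_on ZZ \<eta>"
    and "\<forall>z\<in>ZZ. \<forall>y\<in>YY. \<bar>c z y\<bar> \<le> \<eta> z * (norm y powr \<iota> + 1)"
    and "continuous_map (top_of_set XX) (norm_weak_topology (\<iota> * p))
           (\<lambda>x. distr (\<kappa> x) borel (\<lambda>y. y))"
    and "bounded XX" and "bounded YY"
    and "continuous_on YY r" and "\<forall>y\<in>YY. r y \<ge> 0" and "bounded (r ` YY)" and "\<nu> > 0"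
    and "\<forall>z1\<in>ZZ. \<forall>z2\<in>ZZ. \<forall>y\<in>YY. \<bar>c z1 y - c z2 y\<bar> \<le> r y * norm (z1 - z2) powr \<nu>"
  shows "(\<forall>g\<in>G. \<forall>x\<in>XX. risk_defined p (\<kappa> x) (\<lambda>y. c (g x) y)) \<and>
         (\<forall>g\<in>G. closed XX \<or> bounded (g ` XX) \<longrightarrow>
            risk_defined p P (\<lambda>(x, y). c (g x) y) \<and>
            risk_defined p PX (\<lambda>x. risk_under U p \<rho>2 (\<kappa> x) (\<lambda>y. c (g x) y))) \<and>
         continuous_sup_dist XX G (\<lambda>g. risk_under U p \<rho>EA P (\<lambda>(x, y). c (g x) y)) \<and>
         continuous_sup_dist XX G
           (\<lambda>g. risk_under U p \<rho>1 PX (\<lambda>x. risk_under U p \<rho>2 (\<kappa> x) (\<lambda>y. c (g x) y)))"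
proof -
  have [simp]: "space (restrict_space borel S) = S" for S :: "'u::topological_space set"
    by (simp add: space_restrict_space)
  interpret \<Omega>: prob_space \<Omega>
    by fact
  interpret \<rho>1: uniform_convex_risk M p \<rho>1 U
    using assms by (simp add: uniform_convex_risk_def uniform_convex_risk_axioms_def
        convex_risk_def convex_risk_axioms_def)
  interpret \<rho>2: uniform_convex_risk M p \<rho>2 U
    using assms by (simp add: uniform_convex_risk_def uniform_convex_risk_axioms_def
        convex_risk_def convex_risk_axioms_def)
  interpret \<rho>EA: uniform_convex_risk M p \<rho>EA U
    using assms by (simp add: uniform_convex_risk_def uniform_convex_risk_axioms_def
        convex_risk_def convex_risk_axioms_def)
  have p0: "p \<ge> 0"
    using \<open>p \<ge> 1\<close> by simp
  let ?SX = "restrict_space borel XX" and ?SY = "restrict_space borel YY"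
  define \<phi> where "\<phi> g = (\<lambda>(x, y). c (g x) y)" for g :: "real ^ 'dx \<Rightarrow> real ^ 'dz"
  define \<psi> where "\<psi> g x = risk_under U p \<rho>2 (\<kappa> x) (\<lambda>y. c (g x) y)"
    for g :: "real ^ 'dx \<Rightarrow> real ^ 'dz" and x
  have X: "X \<in> \<Omega> \<rightarrow>\<^sub>M ?SX" and Y: "Y \<in> \<Omega> \<rightarrow>\<^sub>M ?SY"
    by fact+
  have XY: "(\<lambda>\<omega>. (X \<omega>, Y \<omega>)) \<in> \<Omega> \<rightarrow>\<^sub>M restrict_space borel (XX \<times> YY)"
    using measurable_compose[OF measurable_Pair[OF X Y] measurable_pair_restrict_borel] .
  have P: "prob_space P" "sets P = sets (restrict_space borel (XX \<times> YY))" "space P = XX \<times> YY"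
    using \<Omega>.prob_space_distr[OF XY] by (simp_all add: \<open>P = _\<close>)
  have PX: "prob_space PX" "sets PX = sets ?SX" "space PX = XX"
    using \<Omega>.prob_space_distr[OF X] by (simp_all add: \<open>PX = _\<close>)
  have \<kappa>: "\<kappa> \<in> ?SX \<rightarrow>\<^sub>M prob_algebra ?SY"
    using \<open>conditional_law XX YY P PX \<kappa>\<close> by (simp add: conditional_law_def)
  have \<kappa>x: "prob_space (\<kappa> x)" "sets (\<kappa> x) = sets ?SY" "space (\<kappa> x) = YY" if "x \<in> XX" for x
  proof -
    show "prob_space (\<kappa> x)" and eq: "sets (\<kappa> x) = sets ?SY"
      using measurable_space[OF \<kappa>, of x] that by (simp_all add: space_prob_algebra)
    show "space (\<kappa> x) = YY"
      using sets_eq_imp_space_eq[OF eq] by simp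
  qed

  \<comment> \<open>Bounds on the cost\<close>
  obtain R where R: "R > 0" "\<And>y. y \<in> YY \<Longrightarrow> r y \<le> R"
  proof -
    obtain a where "\<And>y. y \<in> YY \<Longrightarrow> norm (r y) \<le> a"
      using \<open>bounded (r ` YY)\<close> by (auto simp: bounded_iff)
    \<comment> \<open>The maximum with 1 makes \<open>R\<close> positive, as the later division by
      \<open>R\<close> requires.\<close>
    then show ?thesis
      using that[of "max 1 a"] by fastforce
  qed
  have lip: "\<bar>c z1 y - c z2 y\<bar> \<le> R * norm (z1 - z2) powr \<nu>"
    if "z1 \<in> ZZ" "z2 \<in> ZZ" "y \<in> YY" for z1 z2 y
  proof -
    have "\<bar>c z1 y - c z2 y\<bar> \<le> r y * norm (z1 - z2) powr \<nu>"
      using assms that by blast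
    also have "\<dots> \<le> R * norm (z1 - z2) powr \<nu>"
      using R(2)[OF that(3)] by (intro mult_right_mono) auto
    finally show ?thesis .
  qed
  have c_bounded: "\<exists>K. \<forall>y\<in>YY. \<bar>c z y\<bar> \<le> K" if "z \<in> ZZ" for z
  proof -
    obtain B where B: "\<And>y. y \<in> YY \<Longrightarrow> norm y \<le> B"
      using \<open>bounded YY\<close> by (auto simp: bounded_iff)
    have "\<bar>c z y\<bar> \<le> \<eta> z * (B powr \<iota> + 1)" if "y \<in> YY" for y
    proof -
      have "\<bar>c z y\<bar> \<le> \<eta> z * (norm y powr \<iota> + 1)"
        using assms \<open>z \<in> ZZ\<close> that by blast
      also have "\<dots> \<le> \<eta> z * (B powr \<iota> + 1)"
        using B[OF that] \<open>\<iota> \<ge> 0\<close> \<open>\<forall>z\<in>ZZ. \<eta> z \<ge> 0\<close> \<open>z \<in> ZZ\<close>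
        by (intro mult_left_mono add_right_mono powr_mono2) auto
      finally show ?thesis .
    qed
    then show ?thesis
      by blast
  qed
  have G: "continuous_on XX g" "\<And>x. x \<in> XX \<Longrightarrow> g x \<in> ZZ" if "g \<in> G" for g
    using that unfolding \<open>G = _\<close> by auto

  \<comment> \<open>Measurability and definedness of costs and conditional risks\<close>
  have \<phi>_meas: "\<phi> g \<in> borel_measurable (restrict_space borel (XX \<times> YY))" if "g \<in> G" for g
  proof (rule borel_measurable_continuous_on_restrict)
    have "continuous_on (XX \<times> YY) (\<lambda>w. (g (fst w), snd w))"
      by (intro continuous_intros continuous_on_compose2[OF G(1)[OF that]]) auto
    then have "continuous_on (XX \<times> YY) (\<lambda>w. (\<lambda>(z, y). c z y) (g (fst w), snd w))"
      by (rule continuous_on_compose2[OF \<open>continuous_on (ZZ \<times> YY) _\<close>]) (use G(2)[OF that] in auto)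
    then show "continuous_on (XX \<times> YY) (\<phi> g)"
      by (simp add: \<phi>_def case_prod_unfold)
  qed
  have \<phi>P: "\<phi> g \<in> borel_measurable P" if "g \<in> G" for g
    using \<phi>_meas[OF that] by (simp cong: measurable_cong_sets add: P(2))
  have \<phi>_pair: "\<phi> g \<in> borel_measurable (?SX \<Otimes>\<^sub>M ?SY)" if "g \<in> G" for g
    using measurable_compose[OF measurable_pair_restrict_borel \<phi>_meas[OF that]] .
  have c_meas: "(\<lambda>y. c (g x) y) \<in> borel_measurable (\<kappa> x)" if "g \<in> G" "x \<in> XX" for g x
  proof -
    have "(\<lambda>y. \<phi> g (x, y)) \<in> borel_measurable ?SY"
      by (rule measurable_compose[OF measurable_Pair1' \<phi>_pair[OF that(1)]]) (simp add: that)
    then show ?thesis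
      by (simp add: \<phi>_def measurable_cong_sets[OF \<kappa>x(2)[OF that(2)] refl])
  qed
  have defined: "risk_defined p (\<kappa> x) (\<lambda>y. c (g x) y)" if g: "g \<in> G" and x: "x \<in> XX" for g x
  proof -
    interpret K: prob_space "\<kappa> x"
      by (rule \<kappa>x[OF x])
    obtain K where "\<forall>y\<in>YY. \<bar>c (g x) y\<bar> \<le> K"
      using c_bounded[OF G(2)[OF g x]] by blast
    then have "(\<lambda>y. c (g x) y) \<in> Lp (\<kappa> x) p"
      by (intro K.Lp_bounded[where K = K] c_meas g x p0) (auto simp: \<kappa>x[OF x])
    then show ?thesis
      by (simp add: risk_defined_iff_Lp[OF \<kappa>x(1)[OF x]])
  qed

  have \<psi>PX: "\<psi> g \<in> borel_measurable PX" if g: "g \<in> G" for g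
  proof -
    \<comment> \<open>The law of the cost under \<open>\<kappa> x\<close>, itself a kernel in
      \<open>x\<close>. On \<open>XX\<close> the conditional risk is defined, so
      \<open>\<psi> g x\<close> is the value of \<open>law_functional\<close> at this law.\<close>
    let ?\<mu> = "\<lambda>x. distr (\<kappa> x) borel (\<lambda>y. c (g x) y)"
    have "?\<mu> \<in> ?SX \<rightarrow>\<^sub>M prob_algebra borel"
      by (rule measurable_distr_prob_space2[OF \<kappa>]) (use \<phi>_pair[OF g] in \<open>simp add: \<phi>_def\<close>)
    then have "(\<lambda>x. law_functional U \<rho>2 (?\<mu> x)) \<in> borel_measurable ?SX"
    proof (rule \<rho>2.measurable_law_functional)
      fix x assume "x \<in> space ?SX"
      then have x: "x \<in> XX"
        by simp
      obtain K where "\<forall>y\<in>YY. \<bar>c (g x) y\<bar> \<le> K"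
        using c_bounded[OF G(2)[OF g x]] by blast
      then have "AE t in ?\<mu> x. \<bar>t\<bar> \<le> K"
        by (subst AE_distr_iff[OF c_meas[OF g x]]) (auto simp: \<kappa>x[OF x])
      then show "\<exists>K. AE t in ?\<mu> x. \<bar>t\<bar> \<le> K"
        by blast
    qed
    also have "(\<lambda>x. law_functional U \<rho>2 (?\<mu> x)) \<in> borel_measurable ?SX
        \<longleftrightarrow> \<psi> g \<in> borel_measurable ?SX"
      by (rule measurable_cong) (simp add: \<psi>_def risk_under_def defined g)
    finally show ?thesis
      by (simp cong: measurable_cong_sets add: PX(2))
  qed

  have defined_bounded: "risk_defined p P (\<phi> g) \<and> risk_defined p PX (\<psi> g)"
    if g: "g \<in> G" and bd: "closed XX \<or> bounded (g ` XX)" for g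
  proof -
    interpret P: prob_space P
      by (rule P)
    interpret PX: prob_space PX
      by (rule PX)
    \<comment> \<open>A closed bounded \<open>XX\<close> is compact, hence so is its continuous
      image.\<close>
    have "bounded (g ` XX)"
      using bd compact_continuous_image[OF G(1)[OF g]] \<open>bounded XX\<close>
      by (auto simp: compact_eq_bounded_closed)
    \<comment> \<open>The growth condition is used at a reference point \<open>z0\<close>; the
      Hoelder estimate \<open>lip\<close> carries the bound to all \<open>g x\<close>, which lie
      within distance \<open>B\<close> of \<open>z0\<close>.\<close>
    obtain z0 where z0: "z0 \<in> ZZ"
      using \<open>ZZ \<noteq> {}\<close> by blast
    obtain K0 where K0: "\<forall>y\<in>YY. \<bar>c z0 y\<bar> \<le> K0"
      using c_bounded[OF z0] by blast
    obtain B where B: "\<And>x. x \<in> XX \<Longrightarrow> dist z0 (g x) \<le> B"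
      using \<open>bounded (g ` XX)\<close> by (auto simp: bounded_any_center[where a = z0])
    define K where "K = K0 + R * B powr \<nu>"
    have K: "\<bar>c (g x) y\<bar> \<le> K" if "x \<in> XX" "y \<in> YY" for x y
    proof -
      have "\<bar>c (g x) y - c z0 y\<bar> \<le> R * norm (g x - z0) powr \<nu>"
        by (rule lip[OF G(2)[OF g that(1)] z0 that(2)])
      also have "\<dots> \<le> R * B powr \<nu>"
        using B[OF that(1)] R(1) \<open>\<nu> > 0\<close>
        by (intro mult_left_mono powr_mono2) (auto simp: dist_norm norm_minus_commute)
      finally show ?thesis
        using K0 that(2) by (fastforce simp: K_def)
    qed
    have "\<phi> g \<in> Lp P p"
      by (rule P.Lp_bounded[OF \<phi>P[OF g] _ p0, where K = K]) (use K in \<open>auto simp: P \<phi>_def\<close>)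
    moreover have "\<psi> g \<in> Lp PX p"
    proof (rule PX.Lp_bounded[OF \<psi>PX[OF g] _ p0])
      \<comment> \<open>\<open>?C\<close> is the risk of zero cost under every
        \<open>\<kappa> x\<close>; comparison with a cost bounded by \<open>K\<close> bounds
        \<open>\<psi> g\<close> uniformly on \<open>XX\<close>.\<close>
      let ?C = "law_functional U \<rho>2 (return borel 0)"
      have "\<bar>\<psi> g x - ?C\<bar> \<le> K" if "x \<in> XX" for x
        unfolding \<psi>_def \<rho>2.risk_under_zero[OF \<kappa>x(1)[OF that], symmetric]
        by (rule \<rho>2.risk_under_lipschitz[OF \<kappa>x(1)[OF that] c_meas[OF g that]])
           (use K that in \<open>auto simp: \<kappa>x\<close>)
      then have "\<bar>\<psi> g x\<bar> \<le> \<bar>?C\<bar> + K" if "x \<in> XX" for x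
        using that by fastforce
      then show "AE x in PX. \<bar>\<psi> g x\<bar> \<le> \<bar>?C\<bar> + K"
        by (intro AE_I2) (simp add: PX)
    qed
    ultimately show ?thesis
      by (simp add: risk_defined_iff_Lp P PX)
  qed

  \<comment> \<open>A common radius for both risks\<close>
  have close: "\<exists>d>0. \<forall>g\<in>G. sup_dist XX g g0 < ennreal d \<longrightarrow>
      \<bar>risk_under U p \<rho>EA P (\<phi> g) - risk_under U p \<rho>EA P (\<phi> g0)\<bar> < e \<and>
      \<bar>risk_under U p \<rho>1 PX (\<psi> g) - risk_under U p \<rho>1 PX (\<psi> g0)\<bar> < e"
    if g0: "g0 \<in> G" and e: "e > 0" for g0 e
  proof (intro exI[of _ "(e / (2 * R)) powr (1 / \<nu>)"] conjI ballI impI)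
    \<comment> \<open>The radius solves \<open>R * ?d powr \<nu> = e / 2\<close>; halving
      \<open>e\<close> leaves room for a strict inequality after the non-strict Lipschitz
      bound.\<close>
    let ?d = "(e / (2 * R)) powr (1 / \<nu>)"
    show "?d > 0"
      using e R(1) by simp
    fix g assume g: "g \<in> G" and near: "sup_dist XX g g0 < ennreal ?d"
    have d: "R * ?d powr \<nu> = e / 2"
      using e R(1) \<open>\<nu> > 0\<close> by (simp add: powr_powr)
    have le: "\<bar>c (g x) y - c (g0 x) y\<bar> \<le> e / 2" if "x \<in> XX" "y \<in> YY" for x y
    proof -
      have "\<bar>c (g x) y - c (g0 x) y\<bar> \<le> R * norm (g x - g0 x) powr \<nu>"
        using that by (intro lip G(2) g g0)
      also have "\<dots> \<le> R * ?d powr \<nu>"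
        using sup_dist_less_imp[OF near that(1)] R(1) \<open>\<nu> > 0\<close>
        by (intro mult_left_mono powr_mono2) auto
      finally show ?thesis
        unfolding d .
    qed
    have "\<bar>risk_under U p \<rho>EA P (\<phi> g) - risk_under U p \<rho>EA P (\<phi> g0)\<bar> \<le> e / 2"
      by (rule \<rho>EA.risk_under_lipschitz[OF P(1) \<phi>P[OF g] \<phi>P[OF g0]])
         (use le in \<open>auto simp: P \<phi>_def\<close>)
    then show "\<bar>risk_under U p \<rho>EA P (\<phi> g) - risk_under U p \<rho>EA P (\<phi> g0)\<bar> < e"
      using e by simp
    \<comment> \<open>The Lipschitz bound is used twice, for the inner risk at each \<open>x\<close>
      and then for the outer risk, without loss in the constant.\<close>
    have "\<bar>\<psi> g x - \<psi> g0 x\<bar> \<le> e / 2" if "x \<in> XX" for x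
      unfolding \<psi>_def
      by (rule \<rho>2.risk_under_lipschitz[OF \<kappa>x(1)[OF that] c_meas[OF g that] c_meas[OF g0 that]])
         (use le that in \<open>auto simp: \<kappa>x\<close>)
    then have "\<bar>risk_under U p \<rho>1 PX (\<psi> g) - risk_under U p \<rho>1 PX (\<psi> g0)\<bar> \<le> e / 2"
      by (intro \<rho>1.risk_under_lipschitz PX \<psi>PX g g0) (simp add: PX)
    then show "\<bar>risk_under U p \<rho>1 PX (\<psi> g) - risk_under U p \<rho>1 PX (\<psi> g0)\<bar> < e"
      using e by simp
  qed
  have "continuous_sup_dist XX G (\<lambda>g. risk_under U p \<rho>EA P (\<phi> g))"
    and "continuous_sup_dist XX G (\<lambda>g. risk_under U p \<rho>1 PX (\<psi> g))"
    unfolding continuous_sup_dist_def using close by meson+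
  with defined defined_bounded show ?thesis
    unfolding \<phi>_def \<psi>_def[abs_def] by blast
qed

end
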